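(* Let $G$ be a graph and $S\subseteq V(G)$ with $|S|=s$. Then $\mathcal{E}(G;S,q)$ is linear in $q$ if and only if for all $1\leq k\leq s$, $$\sum_{W\in\binom{S}{k}}|\mathrm{Obs}(G;W)|=\binom{s-1}{k-1}\sum_{v\in S}|\mathrm{Obs}(G;\{v\})|.$$
   Context: Graphs are finite and simple; $N[X]$ is the closed neighborhood of $X$. Power domination process on a graph $H$ from $T\subseteq V(H)$: set $B:=N[T]$; then, while some $x\in B$ has exactly one vertex $y$ of $N[x]$ outside $B$, add $y$ to $B$. The final set is $\mathrm{Obs}(H;T)$ (with $\mathrm{Obs}(H;\emptyset)=\emptyset$). For $S\subseteq V(H)$, $\mathcal{E}(H;S,q)=\sum_{W\subseteq S}|\mathrm{Obs}(H;W)|\,q^{|S\setminus W|}(1-q)^{|W|}$. $\binom{S}{k}$ is the set of $k$-element subsets of $S$. *)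

theory Defs
  imports
    "HOL-Computational_Algebra.Polynomial"
    "Graph_Theory.Digraph"
begin

(* Finite simple graphs are the instances of the locale graph of Graph_Theory: finite, symmetric,
   loopfree digraphs without parallel arcs, each edge being a pair of opposite arcs. *)

definition closed_nbhd :: "('a, 'b) pre_digraph \<Rightarrow> 'a set \<Rightarrow> 'a set" where
  "closed_nbhd G X = X \<union> {v. \<exists>u\<in>X. u \<rightarrow>\<^bsub>G\<^esub> v}"

definition pd_step :: "('a, 'b) pre_digraph \<Rightarrow> 'a set \<Rightarrow> 'a set \<Rightarrow> bool" where
  "pd_step G B B' \<longleftrightarrow> (\<exists>x\<in>B. \<exists>y. closed_nbhd G {x} - B = {y} \<and> B' = insert y B)"

definition pd_final :: "('a, 'b) pre_digraph \<Rightarrow> 'a set \<Rightarrow> 'a set \<Rightarrow> bool" where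
  "pd_final G T B \<longleftrightarrow> (pd_step G)\<^sup>*\<^sup>* (closed_nbhd G T) B \<and> (\<nexists>B'. pd_step G B B')"

(* The process is nondeterministic, but its final set is unique: see pd_final_Obs below. *)
definition Obs :: "('a, 'b) pre_digraph \<Rightarrow> 'a set \<Rightarrow> 'a set" where
  "Obs G T = (THE B. pd_final G T B)"

(* A polynomial in the indeterminate q = [:0, 1:]; poly_obs_poly gives its values. *)
definition obs_poly :: "('a, 'b) pre_digraph \<Rightarrow> 'a set \<Rightarrow> real poly" where
  "obs_poly G S = (\<Sum>W\<in>Pow S. of_nat (card (Obs G W))
     * [:0, 1:] ^ card (S - W) * (1 - [:0, 1:]) ^ card W)"

lemma poly_obs_poly:
  "poly (obs_poly G S) q =
     (\<Sum>W\<in>Pow S. real (card (Obs G W)) * q ^ card (S - W) * (1 - q) ^ card W)"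
  by (simp add: obs_poly_def poly_sum)

lemma pd_steps_subset:
  assumes "(pd_step G)\<^sup>*\<^sup>* A B" and "A \<subseteq> C" and "\<nexists>C'. pd_step G C C'"
  shows "B \<subseteq> C"
  using assms(1)
proof (induction rule: rtranclp_induct)
  case base
  then show ?case using assms(2) .
next
  case (step B B')
  then obtain x y where x: "x \<in> B" "closed_nbhd G {x} - B = {y}" "B' = insert y B"
    by (auto simp: pd_step_def)
  have "y \<in> C"
  proof (rule ccontr)
    assume "y \<notin> C"
    then have "closed_nbhd G {x} - C = {y}" using x step.IH by blast
    then have "pd_step G C (insert y C)" using x(1) step.IH by (auto simp: pd_step_def)
    then show False using assms(3) by blast
  qed
  then show ?case using x step.IH by blast
qed

lemma pd_steps_incr: "(pd_step G)\<^sup>*\<^sup>* A B \<Longrightarrow> A \<subseteq> B"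
  by (induction rule: rtranclp_induct) (auto simp: pd_step_def)

lemma pd_final_subset:
  assumes "pd_final G T B" and "pd_final G T C"
  shows "B \<subseteq> C"
proof (rule pd_steps_subset)
  show "(pd_step G)\<^sup>*\<^sup>* (closed_nbhd G T) B"
    using assms(1) by (simp add: pd_final_def)
  show "closed_nbhd G T \<subseteq> C"
    using assms(2) by (auto simp: pd_final_def dest: pd_steps_incr)
  show "\<nexists>C'. pd_step G C C'"
    using assms(2) by (simp add: pd_final_def)
qed

lemma pd_final_unique: "pd_final G T B \<Longrightarrow> pd_final G T C \<Longrightarrow> B = C"
  by (rule subset_antisym) (rule pd_final_subset; assumption)+

context wf_digraph
begin

lemma closed_nbhd_subset: "X \<subseteq> verts G \<Longrightarrow> closed_nbhd G X \<subseteq> verts G"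
  by (auto simp: closed_nbhd_def adj_in_verts)

lemma pd_step_subset:
  assumes "pd_step G B B'" and "B \<subseteq> verts G"
  shows "B \<subset> B' \<and> B' \<subseteq> verts G"
proof -
  obtain x y where x: "x \<in> B" "closed_nbhd G {x} - B = {y}" "B' = insert y B"
    using assms(1) by (auto simp: pd_step_def)
  then have "y \<in> closed_nbhd G {x}" "y \<notin> B" by auto
  moreover have "closed_nbhd G {x} \<subseteq> verts G"
    using x(1) assms(2) by (intro closed_nbhd_subset) auto
  ultimately show ?thesis using x(3) assms(2) by auto
qed

end

context fin_digraph
begin

lemma pd_process_terminates:
  "B \<subseteq> verts G \<Longrightarrow> \<exists>C. (pd_step G)\<^sup>*\<^sup>* B C \<and> (\<nexists>C'. pd_step G C C')"
proof (induction "card (verts G - B)" arbitrary: B rule: less_induct)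
  case less
  show ?case
  proof (cases "\<exists>B'. pd_step G B B'")
    case True
    then obtain B' where B': "pd_step G B B'" by blast
    then have "B \<subset> B'" "B' \<subseteq> verts G" using pd_step_subset[OF B' less.prems] by simp_all
    then have "card (verts G - B') < card (verts G - B)"
      by (intro psubset_card_mono) auto
    then obtain C where C: "(pd_step G)\<^sup>*\<^sup>* B' C" "\<nexists>C'. pd_step G C C'"
      using less.hyps[OF _ \<open>B' \<subseteq> verts G\<close>] by auto
    then show ?thesis
      using converse_rtranclp_into_rtranclp[of "pd_step G", OF B' C(1)] by auto
  next
    case False
    then show ?thesis by (intro exI[of _ B]) simp
  qed
qed

lemma pd_final_Obs:
  assumes "T \<subseteq> verts G"
  shows "pd_final G T (Obs G T)"
proof -
  obtain C where C: "pd_final G T C"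
    using pd_process_terminates[OF closed_nbhd_subset[OF assms]] by (auto simp: pd_final_def)
  show ?thesis
    unfolding Obs_def using C pd_final_unique[OF _ C] by (rule theI)
qed

end

lemma Obs_empty [simp]: "Obs G {} = {}"
proof -
  have fin: "pd_final G {} {}" by (auto simp: pd_final_def closed_nbhd_def pd_step_def)
  show ?thesis
    unfolding Obs_def using fin pd_final_unique[OF _ fin] by (rule the_equality)
qed

end

theory Submission
  imports Defs
begin

text \<open>Grouping the terms by the size of \<open>W\<close> writes the polynomial in the Bernstein basis
  \<open>q\<^sup>s\<^sup>-\<^sup>k (1 - q)\<^sup>k\<close>, with coefficients the sums of \<open>|Obs(G;W)|\<close> over the sets \<open>W\<close> of size
  \<open>k\<close>. As \<open>Obs(G;\<emptyset>) = \<emptyset>\<close>, the polynomial vanishes at \<open>q = 1\<close>, so it is linear iff it equals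
  \<open>c (1 - q) = c (1 - q) (q + (1 - q))\<^sup>s\<^sup>-\<^sup>1\<close> for some \<open>c\<close>. The latter has Bernstein
  coefficients \<open>c\<close> times \<open>s - 1\<close> choose \<open>k - 1\<close>, and comparing them at \<open>k = 1\<close> determines \<open>c\<close>.\<close>

text \<open>At 0 every term with a positive power of the indeterminate vanishes, which isolates the
  top coefficient. Once that is zero, the indeterminate divides all remaining terms and cancels in
  an integral domain, leaving the same relation for the next smaller degree.\<close>

lemma bernstein_coeffs_eq_0:
  fixes c :: "nat \<Rightarrow> 'a::idom"
  assumes "(\<Sum>k\<le>s. smult (c k) ([:0, 1:] ^ (s - k) * (1 - [:0, 1:]) ^ k)) = 0" and "k \<le> s"
  shows "c k = 0"
  using assms
proof (induction s arbitrary: k)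
  case 0
  then show ?case by simp
next
  case (Suc s)
  let ?X = "[:0, 1:] :: 'a poly"
  have "poly (\<Sum>k\<le>Suc s. smult (c k) (?X ^ (Suc s - k) * (1 - ?X) ^ k)) 0 = c (Suc s)"
    by (simp add: poly_sum power_0_left)
  then have top: "c (Suc s) = 0"
    unfolding Suc.prems(1) by simp
  have "?X * (\<Sum>k\<le>s. smult (c k) (?X ^ (s - k) * (1 - ?X) ^ k))
      = (\<Sum>k\<le>s. smult (c k) (?X ^ (Suc s - k) * (1 - ?X) ^ k))"
    unfolding sum_distrib_left
    by (rule sum.cong) (simp_all add: Suc_diff_le mult.assoc del: mult_pCons_left)
  also have "\<dots> = 0"
    using Suc.prems(1) top by simp
  finally have "(\<Sum>k\<le>s. smult (c k) (?X ^ (s - k) * (1 - ?X) ^ k)) = 0"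
    unfolding mult_eq_0_iff by simp
  then show ?case
    using Suc.IH top Suc.prems(2) le_Suc_eq by blast
qed

lemma smult_sum_right:
  "smult c (\<Sum>i\<in>A. f i) = (\<Sum>i\<in>A. smult c (f i))"
  by (induction A rule: infinite_finite_induct) (simp_all add: smult_add_right)

text \<open>The extra factor \<open>1 - X\<close> in front of the binomial expansion raises each
  index by one, hence the lower entry \<open>k - 1\<close>. The case \<open>k = 0\<close> is
  separate because truncated subtraction would give \<open>n choose 0 = 1\<close> there.\<close>

lemma bernstein_one_minus_X:
  fixes c :: "'a::comm_ring_1"
  shows "smult c (1 - [:0, 1:]) =
    (\<Sum>k\<le>Suc n. smult (if k = 0 then 0 else c * of_nat (n choose (k - 1)))
       ([:0, 1:] ^ (Suc n - k) * (1 - [:0, 1:]) ^ k))"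
proof -
  let ?X = "[:0, 1:] :: 'a poly"
  have "1 = ((1 - ?X) + ?X) ^ n" by simp
  also have "\<dots> = (\<Sum>k\<le>n. of_nat (n choose k) * (1 - ?X) ^ k * ?X ^ (n - k))"
    by (rule binomial_ring)
  finally have "smult c (1 - ?X)
      = smult c ((1 - ?X) * (\<Sum>k\<le>n. of_nat (n choose k) * (1 - ?X) ^ k * ?X ^ (n - k)))"
    by simp
  also have "\<dots> = (\<Sum>k\<le>n.
      smult c ((1 - ?X) * (smult (of_nat (n choose k)) ((1 - ?X) ^ k) * ?X ^ (n - k))))"
    unfolding sum_distrib_left smult_sum_right by (simp add: of_nat_poly)
  also have "\<dots> = (\<Sum>k\<le>n. smult (c * of_nat (n choose k)) (?X ^ (n - k) * (1 - ?X) ^ Suc k))"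
    by (rule sum.cong) (simp_all add: mult_ac del: mult_pCons_left mult_pCons_right)
  finally show ?thesis
    by (simp add: sum.atMost_Suc_shift del: sum.atMost_Suc)
qed

lemma obs_poly_bernstein:
  assumes "finite S"
  shows "obs_poly G S = (\<Sum>k\<le>card S.
    smult (real (\<Sum>W | W \<subseteq> S \<and> card W = k. card (Obs G W)))
      ([:0, 1:] ^ (card S - k) * (1 - [:0, 1:]) ^ k))"
proof -
  let ?X = "[:0, 1:] :: real poly"
  let ?f = "\<lambda>W. smult (real (card (Obs G W))) (?X ^ (card S - card W) * (1 - ?X) ^ card W)"
  have "obs_poly G S = (\<Sum>W\<in>Pow S. ?f W)"
    unfolding obs_poly_def using assms
    by (intro sum.cong) (auto simp: of_nat_poly card_Diff_subset finite_subset)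
  also have "\<dots> = (\<Sum>k\<le>card S. \<Sum>W | W \<in> Pow S \<and> card W = k. ?f W)"
    using assms by (intro sum.group[symmetric]) (auto intro: card_mono)
  also have "\<dots> = (\<Sum>k\<le>card S. smult (real (\<Sum>W | W \<subseteq> S \<and> card W = k. card (Obs G W)))
      (?X ^ (card S - k) * (1 - ?X) ^ k))"
    by (intro sum.cong) (auto simp: smult_sum)
  finally show ?thesis .
qed

lemma degree_le_1_root_1:
  fixes p :: "'a::comm_ring_1 poly"
  assumes "degree p \<le> 1" and "poly p 1 = 0"
  shows "p = smult (coeff p 0) (1 - [:0, 1:])"
proof -
  obtain a b where p: "p = [:a, b:]"
    using assms(1) degree1_coeffs[of p] degree_0_id[of p]
    by (metis le_Suc_eq One_nat_def le_zero_eq pCons_0_0)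
  with assms(2) have "b = - a"
    by (simp add: add_eq_0_iff)
  with p show ?thesis by (simp add: one_pCons)
qed

lemma sum_card_Obs_singletons:
  "(\<Sum>W | W \<subseteq> S \<and> card W = 1. card (Obs G W)) = (\<Sum>v\<in>S. card (Obs G {v}))"
proof -
  have "{W. W \<subseteq> S \<and> card W = 1} = (\<lambda>v. {v}) ` S"
    by (auto simp: card_1_singleton_iff)
  then show ?thesis
    by (simp add: sum.reindex)
qed

theorem theorem3p3:
  fixes G :: "('a, 'b) pre_digraph" and S :: "'a set" and s :: nat
  assumes "graph G" and "S \<subseteq> verts G" and "card S = s"
  shows "degree (obs_poly G S) \<le> 1 \<longleftrightarrow>
    (\<forall>k. 1 \<le> k \<and> k \<le> s \<longrightarrow>
      (\<Sum>W | W \<subseteq> S \<and> card W = k. card (Obs G W))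
        = ((s - 1) choose (k - 1)) * (\<Sum>v\<in>S. card (Obs G {v})))"
proof -
  interpret graph G by fact
  have fin: "finite S"
    using assms(2) finite_verts by (rule finite_subset)
  define a where "a k = (\<Sum>W | W \<subseteq> S \<and> card W = k. card (Obs G W))" for k
  define B where "B k = [:0, 1:] ^ (s - k) * (1 - [:0, 1:] :: real poly) ^ k" for k
  have P: "obs_poly G S = (\<Sum>k\<le>s. smult (real (a k)) (B k))"
    using obs_poly_bernstein[OF fin] assms(3) by (simp add: a_def B_def)
  have "{W. W \<subseteq> S \<and> card W = 0} = {{}}"
    using fin by (auto simp: finite_subset)
  then have a0: "a 0 = 0"
    by (simp add: a_def)
  have a1: "(\<Sum>v\<in>S. card (Obs G {v})) = a 1"
    by (simp only: a_def sum_card_Obs_singletons)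
  have "degree (obs_poly G S) \<le> 1 \<longleftrightarrow>
    (\<forall>k. 1 \<le> k \<and> k \<le> s \<longrightarrow> a k = ((s - 1) choose (k - 1)) * a 1)"
  \<comment> \<open>For \<open>s = 0\<close> both sides hold: the polynomial is zero and no
    \<open>k\<close> qualifies. Otherwise \<open>s - 1\<close> is the exponent \<open>n\<close> of
    the binomial expansion.\<close>
  proof (cases s)
    case 0
    then show ?thesis by (simp add: P a0)
  next
    case (Suc n)
    define d where "d c k = (if k = 0 then 0 else c * real (n choose (k - 1)))" for c k
    have lin: "smult c (1 - [:0, 1:]) = (\<Sum>k\<le>s. smult (d c k) (B k))" for c
      using bernstein_one_minus_X[of c n] by (simp only: Suc d_def B_def)
    show ?thesis
    proof
      assume deg: "degree (obs_poly G S) \<le> 1"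
      \<comment> \<open>At 1 the factor \<open>(1 - q) ^ k\<close> kills every term but
        \<open>k = 0\<close>.\<close>
      have "poly (obs_poly G S) 1 = real (a 0)"
        unfolding P B_def by (simp add: poly_sum power_0_left sum.atMost_shift)
      then obtain c where "obs_poly G S = smult c (1 - [:0, 1:])"
        using degree_le_1_root_1[OF deg] a0 by auto
      \<comment> \<open>Two expansions of one polynomial are subtracted, so that independence of the
        basis compares coefficients.\<close>
      then have "(\<Sum>k\<le>s. smult (real (a k) - d c k) (B k)) = 0"
        by (simp add: P lin smult_diff_left sum_subtractf)
      then have eq: "real (a k) = d c k" if "k \<le> s" for k
        using bernstein_coeffs_eq_0[of "\<lambda>k. real (a k) - d c k" s k] that by (simp add: B_def)
      have "c = a 1"
        using eq[of 1] Suc by (simp add: d_def)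
      show "\<forall>k. 1 \<le> k \<and> k \<le> s \<longrightarrow> a k = ((s - 1) choose (k - 1)) * a 1"
      proof (intro allI impI)
        fix k assume "1 \<le> k \<and> k \<le> s"
        then have "real (a k) = real (((s - 1) choose (k - 1)) * a 1)"
          using eq[of k] \<open>c = a 1\<close> Suc by (simp add: d_def)
        then show "a k = ((s - 1) choose (k - 1)) * a 1"
          by (simp only: of_nat_eq_iff)
      qed
    next
      assume eq: "\<forall>k. 1 \<le> k \<and> k \<le> s \<longrightarrow> a k = ((s - 1) choose (k - 1)) * a 1"
      \<comment> \<open>The hypothesis starts at \<open>k = 1\<close>; at \<open>k = 0\<close> both
        sides are zero, by \<open>a0\<close> and the default value of \<open>d\<close>.\<close>
      have "real (a k) = d (real (a 1)) k" if "k \<le> s" for k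
        using eq[rule_format, of k] that a0 Suc by (cases "k = 0") (simp_all add: d_def)
      then have "obs_poly G S = smult (real (a 1)) (1 - [:0, 1:])"
        unfolding P lin by (intro sum.cong) auto
      then show "degree (obs_poly G S) \<le> 1"
        by (simp add: one_pCons)
    qed
  qed
  then show ?thesis
    by (simp only: a1 a_def[symmetric])
qed

end
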